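(* Let $(X,d,\mu)$ be a metric measure space with doubling measure $\mu$ (as described in the context), and let $E\subset X$ be a nonempty set. Then the upper Assouad codimension $\overline{\operatorname{co\,dim}}_A(E)$ equals the infimum of all $\alpha>0$ for which $E$ satisfies the upper Aikawa condition with exponent $\alpha$.
   Context: Setting. $X=(X,d,\mu)$ is a metric measure space with at least two points, where $\mu$ is a Borel measure supported on $X$ such that $0<\mu(B)<\infty$ for all open balls $B=B(x,r)=\{y\in X: d(x,y)<r\}$, $x\in X$, $r>0$. The measure $\mu$ is doubling: there is a constant $c_\mu>1$ such that $\mu(B(x,2r))\le c_\mu\,\mu(B(x,r))$ for all $x\in X$ and $r>0$. Write $dy=d\mu(y)$. For a nonempty set $E\subset X$, $\operatorname{dist}(x,E)=\inf\{d(x,y):y\in E\}$, and for $r>0$ the open $r$-neighbourhood is $E_r=\{x\in X:\operatorname{dist}(x,E)<r\}$. $\mathbf 1_K$ is the characteristic function of $K$. Diameters may be infinite. Upper Assouad codimension. For a nonempty set $E\subset X$, $\overline{\operatorname{co\,dim}}_A(E)$ is the infimum of all $Q\ge 0$ for which there exists a constant $c>0$ such that $$\frac{\mu(E_r\cap B(z,R))}{\mu(B(z,R))}\ge c\Bigl(\frac rR\Bigr)^Q$$ for every $z\in E$ and all $0<r<R<\operatorname{diam}(E)$. If $\operatorname{diam}(E)=0$, the restriction $R<\operatorname{diam}(E)$ is replaced with $R<\operatorname{diam}(X)$. Upper Aikawa condition. Let $E\subset X$ be nonempty and $\alpha>0$. $E$ satisfies the upper Aikawa condition with exponent $\alpha$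 if for every $\varepsilon>0$ there exists $\delta>0$ such that $$\frac{1}{\mu(B(z,R))}\int_{B(z,R)}\frac{\mathbf 1_K(y)}{\operatorname{dist}(y,E)^\alpha}\,dy\ \ge\ \frac{R^{-\alpha}}{\varepsilon}$$ whenever $z\in E$, $0<R<\operatorname{diam}(E)$ and $K\subset X$ is a Borel set with $\mu(B(z,R)\setminus K)\le\delta\,\mu(B(z,R))$. If $\operatorname{diam}(E)=0$, the restriction $R<\operatorname{diam}(E)$ is replaced with $R<\operatorname{diam}(X)$. The integrand takes values in $[0,\infty]$: it equals $+\infty$ at points $y\in K$ with $\operatorname{dist}(y,E)=0$, and $0$ at points $y\notin K$. *)

theory Defs
  imports "HOL-Analysis.Analysis"
begin

text \<open>The metric space is the whole type, so \<^term>\<open>UNIV\<close> plays the role of $X$.\<close>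

definition doubling_metric_measure :: "'a::metric_space measure \<Rightarrow> bool" where
  "doubling_metric_measure M \<longleftrightarrow>
     (\<exists>x y :: 'a. x \<noteq> y) \<and>
     sets M = sets borel \<and>
     (\<forall>x r. r > 0 \<longrightarrow> 0 < emeasure M (ball x r) \<and> emeasure M (ball x r) < \<infinity>) \<and>
     (\<exists>c>1. \<forall>x r. r > 0 \<longrightarrow>
        emeasure M (ball x (2 * r)) \<le> ennreal c * emeasure M (ball x r))"

text \<open>The library's \<^const>\<open>diameter\<close> is real-valued and has no meaning on unbounded sets,
  hence an extended version.\<close>

definition ediam :: "'a::metric_space set \<Rightarrow> ennreal" where
  "ediam E = (SUP x\<in>E. SUP y\<in>E. ennreal (dist x y))"

text \<open>Strict upper bound for the admissible radii \<open>R\<close>; when \<open>E\<close> has diameter zero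
  it is the diameter of the whole space.\<close>

definition radius_bound :: "'a::metric_space set \<Rightarrow> ennreal" where
  "radius_bound E = (if ediam E = 0 then ediam (UNIV :: 'a set) else ediam E)"

definition open_nbhd :: "'a::metric_space set \<Rightarrow> real \<Rightarrow> 'a set" where
  "open_nbhd E r = {x. infdist x E < r}"

text \<open>The infimum is taken in the extended reals, so that the infimum of the empty set is
  \<open>\<infinity>\<close> and not an unspecified real number.\<close>

definition upper_Assouad_codim :: "'a::metric_space measure \<Rightarrow> 'a set \<Rightarrow> ereal" where
  "upper_Assouad_codim M E =
     Inf (ereal ` {Q. Q \<ge> 0 \<and>
       (\<exists>c>0. \<forall>z\<in>E. \<forall>r R. 0 < r \<and> r < R \<and> ennreal R < radius_bound E \<longrightarrow>
          measure M (open_nbhd E r \<inter> ball z R) / measure M (ball z R) \<ge> c * (r / R) powr Q)})"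

text \<open>In \<^typ>\<open>ennreal\<close> we have \<open>1 / 0 = \<infinity>\<close> and \<open>0 / 0 = 0\<close>. As \<open>0 powr \<alpha> = 0\<close>, the
  integrand below is \<open>\<infinity>\<close> at the points of \<open>K\<close> at distance zero from \<open>E\<close>, and \<open>0\<close> outside \<open>K\<close>.\<close>

definition upper_Aikawa :: "'a::metric_space measure \<Rightarrow> 'a set \<Rightarrow> real \<Rightarrow> bool" where
  "upper_Aikawa M E \<alpha> \<longleftrightarrow>
     (\<forall>\<epsilon>>0. \<exists>\<delta>>0. \<forall>z\<in>E. \<forall>R K.
        0 < R \<and> ennreal R < radius_bound E \<and> K \<in> sets borel \<and>
        measure M (ball z R - K) \<le> \<delta> * measure M (ball z R) \<longrightarrow>
        (\<integral>\<^sup>+ y\<in>ball z R. (indicator K y / ennreal (infdist y E powr \<alpha>)) \<partial>M)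
            / emeasure M (ball z R)
          \<ge> ennreal (R powr (- \<alpha>) / \<epsilon>))"

lemma upper_Aikawa_integrand:
  fixes K :: "'a::metric_space set"
  shows "y \<in> K \<Longrightarrow> infdist y E = 0 \<Longrightarrow>
           (indicator K y / ennreal (infdist y E powr \<alpha>) :: ennreal) = \<infinity>"
    and "y \<in> K \<Longrightarrow> infdist y E \<noteq> 0 \<Longrightarrow>
           (indicator K y / ennreal (infdist y E powr \<alpha>) :: ennreal)
             = ennreal (1 / infdist y E powr \<alpha>)"
    and "y \<notin> K \<Longrightarrow> (indicator K y / ennreal (infdist y E powr \<alpha>) :: ennreal) = 0"
  by (auto simp: ennreal_divide_self divide_ennreal infdist_nonneg
           simp flip: ennreal_1)

end

theory Submission
  imports Defs
begin

text \<open>One inequality is direct: if the Assouad condition holds with exponent \<open>Q < \<alpha>\<close>, then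
  \<open>E\<^sub>\<lambda>\<^sub>R\<close> fills a fraction \<open>c \<lambda>\<^sup>Q\<close> of \<open>B(z, R)\<close>, at least half of which lies in \<open>K\<close> for small
  \<open>\<delta>\<close>; there the integrand exceeds \<open>(\<lambda>R) powr (-\<alpha>)\<close>, and \<open>\<lambda>\<close> can be taken small.

  Conversely, assume the Aikawa condition with exponent \<open>\<alpha>\<close> and let \<open>Q > \<alpha>\<close>. Testing it with
  the complement of a small neighbourhood of \<open>E\<close> and splitting the integral into dyadic layers
  yields, for any prescribed constant \<open>C\<close>, a number \<open>N\<close> such that in every ball \<open>B(z, R)\<close> some
  scale \<open>s = R / 2^j\<close> with \<open>1 \<le> j \<le> N\<close> satisfies \<open>\<mu>(E\<^sub>s \<inter> B(z, R)) \<ge> C (s/R)\<^sup>Q \<mu>(B(z, R))\<close>.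
  Choosing \<open>C\<close> so large that it absorbs the loss in passing from \<open>E\<^sub>s\<close> to disjoint balls of
  radius comparable to \<open>s\<close>, one iterates this estimate down to scale \<open>r\<close> without deterioration
  of the constant.\<close>

section \<open>Balls and separated sets under a doubling measure\<close>

lemma ball_subset_ballI:
  fixes z w :: "'a::metric_space"
  assumes "dist z w + a \<le> b"
  shows "ball z a \<subseteq> ball w b"
proof
  fix y assume "y \<in> ball z a"
  then show "y \<in> ball w b"
    using assms dist_triangle3[of w y z] by simp
qed

locale doubling_measure =
  fixes M :: "'a::metric_space measure" and c :: real
  assumes sets_M: "sets M = sets borel"
    and emeasure_ball: "r > 0 \<Longrightarrow> 0 < emeasure M (ball x r) \<and> emeasure M (ball x r) < \<infinity>"
    and c_gt_1: "c > 1"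
    and emeasure_doubling:
      "r > 0 \<Longrightarrow> emeasure M (ball x (2 * r)) \<le> ennreal c * emeasure M (ball x r)"
begin

lemma open_in_sets [intro]: "open A \<Longrightarrow> A \<in> sets M"
  by (simp add: sets_M)

lemma space_M [simp]: "space M = UNIV"
  using sets_eq_imp_space_eq[OF sets_M] by simp

lemma ball_fmeasurable [intro, simp]: "ball x r \<in> fmeasurable M"
proof (cases "r > 0")
  case True
  then show ?thesis
    using emeasure_ball[of r x] by (auto intro!: fmeasurableI)
qed (simp add: ball_empty)

lemma emeasure_ball_eq: "emeasure M (ball x r) = ennreal (measure M (ball x r))"
  by (rule emeasure_eq_measure2) simp

lemma Int_ball_fmeasurable [intro]: "A \<in> sets M \<Longrightarrow> A \<inter> ball x r \<in> fmeasurable M"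
  using fmeasurable_Int_fmeasurable[OF ball_fmeasurable] by (simp add: inf_commute)

lemma emeasure_Int_ball_eq:
  "A \<in> sets M \<Longrightarrow> emeasure M (A \<inter> ball x r) = ennreal (measure M (A \<inter> ball x r))"
  by (rule emeasure_eq_measure2) auto

lemma measure_ball_pos: "r > 0 \<Longrightarrow> 0 < measure M (ball x r)"
  using emeasure_ball[of r x] by (simp add: emeasure_ball_eq)

lemma measure_mono_ball:
  "A \<subseteq> ball x r \<Longrightarrow> A \<in> sets M \<Longrightarrow> measure M A \<le> measure M (ball x r)"
  by (rule measure_mono_fmeasurable) auto

lemma measure_ball_power:
  assumes "r > 0"
  shows "measure M (ball x (2 ^ n * r)) \<le> c ^ n * measure M (ball x r)"
proof (induction n)
  case (Suc n)
  have "measure M (ball x (2 * (2 ^ n * r))) \<le> c * measure M (ball x (2 ^ n * r))"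
    using emeasure_doubling[of "2 ^ n * r" x] assms c_gt_1
    by (simp add: emeasure_ball_eq flip: ennreal_mult)
  also have "\<dots> \<le> c * (c ^ n * measure M (ball x r))"
    using Suc c_gt_1 by simp
  finally show ?case
    by (simp add: mult_ac)
qed simp

text \<open>The separation \<open>2 * t\<close> makes the balls of radius \<open>t\<close> disjoint.
  With \<open>A = UNIV\<close> this bounds the number of separated points; with \<open>A\<close> a
  neighbourhood of \<open>E\<close> it adds up local estimates.\<close>

lemma sum_measure_balls_le:
  assumes "finite W" "pairwise (\<lambda>v w. 2 * t \<le> dist v w) W"
    and "\<And>w. w \<in> W \<Longrightarrow> ball w t \<subseteq> ball z R" "A \<in> sets M"
  shows "(\<Sum>w\<in>W. measure M (A \<inter> ball w t)) \<le> measure M (A \<inter> ball z R)"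
proof -
  have "disjoint_family_on (\<lambda>w. A \<inter> ball w t) W"
    unfolding disjoint_family_on_def
  proof (intro ballI impI)
    fix v w assume "v \<in> W" "w \<in> W" "v \<noteq> w"
    then have "2 * t \<le> dist v w"
      using assms(2) by (auto simp: pairwise_def)
    then have "ball v t \<inter> ball w t = {}"
      by (intro disjoint_ballI) simp
    then show "(A \<inter> ball v t) \<inter> (A \<inter> ball w t) = {}"
      by auto
  qed
  then have "(\<Sum>w\<in>W. measure M (A \<inter> ball w t)) = measure M (\<Union>w\<in>W. A \<inter> ball w t)"
    using assms(1,4)
    by (intro measure_finite_Union[symmetric]) (auto simp: emeasure_Int_ball_eq)
  also have "\<dots> \<le> measure M (A \<inter> ball z R)"
    using assms by (intro measure_mono_fmeasurable) auto
  finally show ?thesis .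
qed

text \<open>Doubling bounds the cardinality of the \<open>t\<close>-separated finite subsets of a
  ball, so one of greatest cardinality exists. It is a \<open>t\<close>-net of \<open>A\<close>,
  since a point far from all of \<open>W\<close> could be added to it.\<close>

lemma exists_maximal_separated:
  fixes z :: 'a
  assumes "t > 0" "A \<subseteq> ball z R"
  obtains W where "finite W" "W \<subseteq> A" "pairwise (\<lambda>v w. t \<le> dist v w) W"
    "\<And>a. a \<in> A \<Longrightarrow> \<exists>w\<in>W. dist w a < t"
proof -
  define P where "P W \<longleftrightarrow> finite W \<and> W \<subseteq> A \<and> pairwise (\<lambda>v w. t \<le> dist v w) W" for W
  \<comment> \<open>After \<open>k\<close> doublings a ball of radius \<open>t / 2\<close> about any
    point of \<open>ball z R\<close> contains \<open>ball z (R + t / 2)\<close>. Each of the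
    disjoint small balls therefore has at least the fraction \<open>1 / c ^ k\<close> of the measure
    of the large one.\<close>
  obtain k where k: "(2 * R + t) / (t / 2) < 2 ^ k"
    using real_arch_pow[of 2] by auto
  have card_le: "card W \<le> nat \<lfloor>c ^ k\<rfloor>" if "P W" for W
  proof (cases "W = {}")
    case False
    with that assms have "R > 0"
      unfolding P_def by (metis all_not_in_conv mem_ball subset_iff zero_le_dist less_le_trans not_less)
    define m where "m = measure M (ball z (R + t / 2))"
    have "m > 0"
      unfolding m_def using assms \<open>R > 0\<close> by (intro measure_ball_pos) auto
    have wm: "m / c ^ k \<le> measure M (ball w (t / 2))" if "w \<in> W" for w
    proof -
      have "dist z w < R"
        using \<open>P W\<close> that assms by (auto simp: P_def)
      moreover have "2 * R + t < 2 ^ k * (t / 2)"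
        using k assms(1) by (simp add: field_simps)
      ultimately have "R + t / 2 + dist z w < 2 ^ k * (t / 2)"
        using \<open>R > 0\<close> assms(1) by linarith
      then have "ball z (R + t / 2) \<subseteq> ball w (2 ^ k * (t / 2))"
        by (intro ball_subset_ballI) simp
      then have "m \<le> measure M (ball w (2 ^ k * (t / 2)))"
        unfolding m_def by (intro measure_mono_ball) auto
      also have "\<dots> \<le> c ^ k * measure M (ball w (t / 2))"
        using assms by (intro measure_ball_power) auto
      finally show ?thesis
        using c_gt_1 by (simp add: field_simps)
    qed
    have "real (card W) * (m / c ^ k) \<le> (\<Sum>w\<in>W. measure M (UNIV \<inter> ball w (t / 2)))"
      by (rule sum_bounded_below) (use wm in simp)
    also have "\<dots> \<le> measure M (UNIV \<inter> ball z (R + t / 2))"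
    proof (rule sum_measure_balls_le)
      show "ball w (t / 2) \<subseteq> ball z (R + t / 2)" if "w \<in> W" for w
        using \<open>P W\<close> that assms by (intro ball_subset_ballI) (force simp: P_def dist_commute)
    qed (use \<open>P W\<close> in \<open>auto simp: P_def\<close>)
    finally have "real (card W) \<le> c ^ k"
      using \<open>m > 0\<close> c_gt_1 by (simp add: m_def field_simps)
    then show ?thesis
      by (simp add: le_nat_floor)
  qed simp
  have "P {}"
    by (simp add: P_def)
  then obtain W where W: "P W" and max: "\<And>V. P V \<Longrightarrow> card V \<le> card W"
    using ex_has_greatest_nat[of P "{}" card "Suc (nat \<lfloor>c ^ k\<rfloor>)"] card_le
    by (metis le_imp_less_Suc)
  have "\<exists>w\<in>W. dist w a < t" if "a \<in> A" for a
  proof (rule ccontr)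
    assume "\<not> ?thesis"
    then have far: "t \<le> dist w a" if "w \<in> W" for w
      using that by force
    then have "a \<notin> W"
      using assms(1) by force
    moreover have "P (insert a W)"
      using W far that by (auto simp: P_def pairwise_insert dist_commute)
    ultimately show False
      using max[of "insert a W"] W by (auto simp: P_def)
  qed
  with W that show ?thesis
    by (auto simp: P_def)
qed

section \<open>From the Assouad condition to the Aikawa condition\<close>

lemma open_open_nbhd [intro]: "open (open_nbhd E r)"
  unfolding open_nbhd_def by (intro open_Collect_less continuous_intros)

lemma ball_subset_open_nbhd: "z \<in> E \<Longrightarrow> ball z r \<subseteq> open_nbhd E r"
  by (auto simp: open_nbhd_def dist_commute intro: le_less_trans infdist_le)

lemma upper_Aikawa_if_Assouad:
  assumes "Q \<ge> 0" "Q < \<alpha>" "b > 0"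
    and Assouad: "\<And>z r R. z \<in> E \<Longrightarrow> 0 < r \<Longrightarrow> r < R \<Longrightarrow> ennreal R < radius_bound E \<Longrightarrow>
          measure M (open_nbhd E r \<inter> ball z R) / measure M (ball z R) \<ge> b * (r / R) powr Q"
  shows "upper_Aikawa M E \<alpha>"
  unfolding upper_Aikawa_def
proof (intro allI impI)
  fix \<epsilon> :: real assume "\<epsilon> > 0"
  \<comment> \<open>The bound \<open>1 / 2\<close> makes \<open>l * R\<close> an admissible inner
    radius. The other entry makes the lower bound \<open>(l * R) powr (-\<alpha>)\<close> of the
    integrand, times the measure fraction \<open>b / 2 * l powr Q\<close>, at least
    \<open>R powr (-\<alpha>) / \<epsilon>\<close>.\<close>
  define l where "l = min (1 / 2) ((b * \<epsilon> / 2) powr (1 / (\<alpha> - Q)))"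
  have l: "l < 1" "0 < l"
    using assms \<open>\<epsilon> > 0\<close> by (auto simp: l_def)
  have "l powr (\<alpha> - Q) \<le> ((b * \<epsilon> / 2) powr (1 / (\<alpha> - Q))) powr (\<alpha> - Q)"
    using assms l by (intro powr_mono2) (auto simp: l_def)
  also have "\<dots> = b * \<epsilon> / 2"
    using assms \<open>\<epsilon> > 0\<close> by (simp add: powr_powr)
  finally have l_powr: "l powr (\<alpha> - Q) \<le> b * \<epsilon> / 2" .
  \<comment> \<open>Half of the fraction that the Assouad condition gives at the scale
    \<open>l * R\<close>: the other half remains after the points outside \<open>K\<close> are
    removed.\<close>
  define \<delta> where "\<delta> = b / 2 * l powr Q"
  show "\<exists>\<delta>>0. \<forall>z\<in>E. \<forall>R K.
        0 < R \<and> ennreal R < radius_bound E \<and> K \<in> sets borel \<and>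
        measure M (ball z R - K) \<le> \<delta> * measure M (ball z R) \<longrightarrow>
        (\<integral>\<^sup>+ y\<in>ball z R. (indicator K y / ennreal (infdist y E powr \<alpha>)) \<partial>M)
            / emeasure M (ball z R)
          \<ge> ennreal (R powr (- \<alpha>) / \<epsilon>)"
  proof (intro exI[of _ \<delta>] conjI ballI allI impI; (elim conjE)?)
    show "\<delta> > 0"
      using \<open>b > 0\<close> l by (simp add: \<delta>_def)
    fix z R K assume "z \<in> E" and R: "0 < R" "ennreal R < radius_bound E"
      and K: "K \<in> sets borel" "measure M (ball z R - K) \<le> \<delta> * measure M (ball z R)"
    define m where "m = measure M (ball z R)"
    define F where "F = K \<inter> open_nbhd E (l * R)"
    have m: "m > 0"
      using R by (simp add: m_def measure_ball_pos)
    have F: "F \<in> sets M"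
      unfolding F_def sets_M by (intro sets.Int K(1) borel_open open_open_nbhd)
    have "b * l powr Q \<le> measure M (open_nbhd E (l * R) \<inter> ball z R) / m"
      using Assouad[of z "l * R" R] \<open>z \<in> E\<close> R l by (simp add: m_def)
    then have "b * l powr Q * m \<le> measure M (open_nbhd E (l * R) \<inter> ball z R)"
      using m by (simp add: field_simps)
    also have "\<dots> \<le> measure M ((F \<inter> ball z R) \<union> (ball z R - K))"
    proof (rule measure_mono_fmeasurable)
      show "open_nbhd E (l * R) \<inter> ball z R \<in> sets M"
        by (intro sets.Int open_in_sets open_open_nbhd open_ball)
      show "(F \<inter> ball z R) \<union> (ball z R - K) \<in> fmeasurable M"
        using K F by (intro fmeasurable.Un Int_ball_fmeasurable fmeasurable_Diff)
          (auto simp: sets_M)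
    qed (auto simp: F_def)
    also have "\<dots> \<le> measure M (F \<inter> ball z R) + measure M (ball z R - K)"
      using K F by (intro measure_Un_le) (auto simp: sets_M)
    finally have Fm: "\<delta> * m \<le> measure M (F \<inter> ball z R)"
      using K(2) by (simp add: \<delta>_def m_def field_simps)
    have "1 * l powr \<alpha> \<le> b * \<epsilon> / 2 * l powr Q"
      using l l_powr by (simp add: powr_diff field_simps)
    then have "1 / \<epsilon> \<le> l powr (- \<alpha>) * \<delta>"
      using l \<open>\<epsilon> > 0\<close> by (simp add: \<delta>_def powr_minus field_simps)
    then have "R powr (- \<alpha>) * (1 / \<epsilon>) \<le> R powr (- \<alpha>) * (l powr (- \<alpha>) * \<delta>)"
      by (intro mult_left_mono) auto
    then have "R powr (- \<alpha>) / \<epsilon> \<le> (l * R) powr (- \<alpha>) * \<delta>"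
      using l R by (simp add: powr_mult mult_ac)
    then have "R powr (- \<alpha>) / \<epsilon> * m \<le> (l * R) powr (- \<alpha>) * \<delta> * m"
      using m by (intro mult_right_mono) auto
    also have "\<dots> \<le> (l * R) powr (- \<alpha>) * measure M (F \<inter> ball z R)"
      using Fm by (simp add: mult.assoc mult_left_mono)
    finally have "ennreal (R powr (- \<alpha>) / \<epsilon> * m)
        \<le> ennreal ((l * R) powr (- \<alpha>)) * emeasure M (F \<inter> ball z R)"
      using F by (simp add: emeasure_Int_ball_eq ennreal_leI flip: ennreal_mult)
    also have "\<dots> = (\<integral>\<^sup>+ y. ennreal ((l * R) powr (- \<alpha>)) * indicator (F \<inter> ball z R) y \<partial>M)"
      using F by (intro nn_integral_cmult_indicator[symmetric]) auto
    also have "\<dots> \<le> (\<integral>\<^sup>+ y\<in>ball z R. (indicator K y / ennreal (infdist y E powr \<alpha>)) \<partial>M)"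
    proof (rule nn_integral_mono)
      fix y
      have "ennreal ((l * R) powr (- \<alpha>)) \<le> indicator K y / ennreal (infdist y E powr \<alpha>)"
        if "y \<in> F"
      proof (cases "infdist y E = 0")
        case False
        then have "infdist y E > 0"
          using infdist_nonneg[of y E] by linarith
        moreover from this have "(l * R) powr (- \<alpha>) \<le> infdist y E powr (- \<alpha>)"
          using that l R assms by (intro powr_mono2') (auto simp: F_def open_nbhd_def)
        ultimately show ?thesis
          using that upper_Aikawa_integrand(2)[of y K E \<alpha>]
          by (simp add: F_def powr_minus_divide ennreal_leI)
      qed (use that upper_Aikawa_integrand(1)[of y K E \<alpha>] in \<open>auto simp: F_def\<close>)
      then show "ennreal ((l * R) powr (- \<alpha>)) * indicator (F \<inter> ball z R) y
          \<le> indicator K y / ennreal (infdist y E powr \<alpha>) * indicator (ball z R) y"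
        by (auto simp: indicator_def)
    qed
    finally have *: "ennreal (R powr (- \<alpha>) / \<epsilon> * m) / ennreal m
        \<le> (\<integral>\<^sup>+ y\<in>ball z R. (indicator K y / ennreal (infdist y E powr \<alpha>)) \<partial>M) / ennreal m"
      by (rule divide_right_mono_ennreal)
    have "ennreal (R powr (- \<alpha>) / \<epsilon> * m) / ennreal m = ennreal (R powr (- \<alpha>) / \<epsilon>)"
      using m \<open>\<epsilon> > 0\<close> by (subst divide_ennreal) auto
    with * show "ennreal (R powr (- \<alpha>) / \<epsilon>)
        \<le> (\<integral>\<^sup>+ y\<in>ball z R. (indicator K y / ennreal (infdist y E powr \<alpha>)) \<partial>M)
            / emeasure M (ball z R)"
      by (simp add: emeasure_ball_eq m_def)
  qed
qed

section \<open>From the Aikawa condition to the Assouad condition\<close>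

text \<open>The index \<open>j\<close> is the one with
  \<open>R / 2 ^ Suc j \<le> d < R / 2 ^ j\<close>. Applied to \<open>d = infdist y E\<close>, it
  dominates the singular weight by a finite sum of weighted indicators of neighbourhoods of
  \<open>E\<close>.\<close>

lemma dyadic_layer_bound:
  fixes d R \<alpha> :: real
  assumes "0 < R" "d < R" "R / 2 ^ N \<le> d" "\<alpha> > 0"
  obtains j where "j < N" "d < R / 2 ^ j" "1 / d powr \<alpha> \<le> (2 ^ Suc j / R) powr \<alpha>"
proof -
  define i where "i = (LEAST i. R / 2 ^ i \<le> d)"
  have i: "R / 2 ^ i \<le> d" "i \<le> N"
    unfolding i_def using assms(3) by (auto intro: LeastI Least_le)
  then obtain j where j: "i = Suc j"
    using assms(2) by (cases i) auto
  have "d < R / 2 ^ j"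
    using not_less_Least[of j "\<lambda>i. R / 2 ^ i \<le> d"] j by (simp add: i_def not_le)
  have "(R / 2 ^ i) powr \<alpha> \<le> d powr \<alpha>"
    using i assms by (intro powr_mono2) auto
  then have "1 / d powr \<alpha> \<le> 1 / (R / 2 ^ i) powr \<alpha>"
    using assms(1) by (intro frac_le) auto
  also have "\<dots> = (2 ^ i / R) powr \<alpha>"
    using assms(1) by (simp add: powr_divide)
  finally show ?thesis
    using that[of j] i j \<open>d < R / 2 ^ j\<close> by auto
qed

text \<open>If all scales from 1 to \<open>N\<close> were thin, the complement of the neighbourhood
  at scale \<open>N\<close> would be an admissible \<open>K\<close>, while its integral would be at
  most half of what the Aikawa condition demands. It matters for the later iteration that
  \<open>N\<close> depends neither on \<open>z\<close> nor on \<open>R\<close>.\<close>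

lemma upper_Aikawa_good_scale:
  assumes Aikawa: "upper_Aikawa M E \<alpha>" and "0 < \<alpha>" "\<alpha> < Q" "1 \<le> C"
  obtains N where "\<And>z R. z \<in> E \<Longrightarrow> 0 < R \<Longrightarrow> ennreal R < radius_bound E \<Longrightarrow>
    \<exists>j\<in>{1..N}. C * (1 / 2 ^ j) powr Q * measure M (ball z R)
      \<le> measure M (open_nbhd E (R / 2 ^ j) \<inter> ball z R)"
proof -
  \<comment> \<open>From one dyadic layer to the next the weight grows by
    \<open>2 powr \<alpha>\<close> and the bound on the measure shrinks by
    \<open>2 powr (-Q)\<close>; \<open>q\<close> is the resulting ratio.\<close>
  define q where "q = 2 powr (\<alpha> - Q)"
  have q: "0 < q" "q < 1"
    using assms by (auto simp: q_def powr_less_one)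
  \<comment> \<open>\<open>D\<close> comes from the full geometric series, so it is independent of
    \<open>N\<close>. This avoids a circle: \<open>\<epsilon>\<close> is fixed by \<open>D\<close>,
    then \<open>\<delta>\<close> by \<open>\<epsilon>\<close>, and only then \<open>N\<close> by
    \<open>\<delta>\<close>.\<close>
  define D where "D = 2 powr \<alpha> * C * (1 / (1 - q))"
  have D: "D > 0"
    using q assms by (simp add: D_def)
  define \<epsilon> where "\<epsilon> = 1 / (2 * D)"
  have "\<epsilon> > 0"
    using D by (simp add: \<epsilon>_def)
  with Aikawa obtain \<delta> where "\<delta> > 0" and \<delta>: "\<And>z R K. z \<in> E \<Longrightarrow> 0 < R \<Longrightarrow>
        ennreal R < radius_bound E \<Longrightarrow> K \<in> sets borel \<Longrightarrow>
        measure M (ball z R - K) \<le> \<delta> * measure M (ball z R) \<Longrightarrow>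
        (\<integral>\<^sup>+ y\<in>ball z R. (indicator K y / ennreal (infdist y E powr \<alpha>)) \<partial>M)
            / emeasure M (ball z R)
          \<ge> ennreal (R powr (- \<alpha>) / \<epsilon>)"
    unfolding upper_Aikawa_def by meson
  have "2 powr (-Q) < 1"
    using assms by (intro powr_less_one) auto
  \<comment> \<open>At this scale a thin neighbourhood occupies at most the fraction
    \<open>\<delta>\<close> of the ball, so that it may be removed from \<open>K\<close>.\<close>
  then obtain n where n: "(2 powr (-Q)) ^ n < \<delta> / C"
    using real_arch_pow_inv[of "\<delta> / C" "2 powr (-Q)"] \<open>\<delta> > 0\<close> assms by auto
  define N where "N = Suc n"
  have pow_powr: "(2 ^ j) powr a = (2 powr a) ^ j" for j :: nat and a :: real
  proof -
    have "(2 ^ j) powr a = (2 powr real j) powr a"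
      by (simp add: powr_realpow)
    also have "\<dots> = (2 powr a) powr real j"
      by (simp only: powr_powr mult.commute)
    finally show ?thesis
      by (simp add: powr_realpow)
  qed
  have powr_half: "(1 / 2 ^ j) powr Q = (2 powr (-Q)) ^ j" for j :: nat
    by (subst powr_divide) (simp_all add: pow_powr powr_minus_divide power_one_over)
  have "(2 powr (-Q)) ^ N \<le> (2 powr (-Q)) ^ n"
    using \<open>2 powr (-Q) < 1\<close> by (intro power_decreasing) (auto simp: N_def)
  with n have "(2 powr (-Q)) ^ N \<le> \<delta> / C"
    by linarith
  then have N: "C * (1 / 2 ^ N) powr Q \<le> \<delta>"
    using assms by (simp add: powr_half field_simps)
  show ?thesis
  proof (rule that[of N], rule ccontr)
    fix z R assume "z \<in> E" and R: "0 < R" "ennreal R < radius_bound E"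
    define m where "m = measure M (ball z R)"
    have m: "m > 0"
      using R by (simp add: m_def measure_ball_pos)
    let ?F = "\<lambda>j. open_nbhd E (R / 2 ^ j) \<inter> ball z R"
    have F_sets [measurable]: "?F j \<in> sets M" for j
      by (intro sets.Int open_in_sets open_open_nbhd open_ball)
    assume "\<not> (\<exists>j\<in>{1..N}. C * (1 / 2 ^ j) powr Q * measure M (ball z R) \<le> measure M (?F j))"
    then have small': "measure M (?F j) \<le> C * (1 / 2 ^ j) powr Q * m" if "j \<in> {1..N}" for j
      using that by (force simp: m_def)
    \<comment> \<open>The negated claim says nothing about \<open>j = 0\<close>, but the outermost
      layer also enters the sum; there the bound is trivial because
      \<open>1 \<le> C\<close>.\<close>
    have small: "measure M (?F j) \<le> C * (1 / 2 ^ j) powr Q * m" if "j \<le> N" for j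
    proof (cases "j = 0")
      case True
      have "measure M (?F j) \<le> 1 * m"
        by (auto simp: m_def intro!: measure_mono_ball)
      also have "\<dots> \<le> C * m"
        using m assms by (intro mult_right_mono) auto
      finally show ?thesis using True by simp
    qed (use small' that in auto)
    define K where "K = - open_nbhd E (R / 2 ^ N)"
    have "ball z R - K = ?F N"
      by (auto simp: K_def)
    then have "measure M (ball z R - K) \<le> C * (1 / 2 ^ N) powr Q * m"
      using small[of N] by simp
    also have "\<dots> \<le> \<delta> * m"
      using N m by (intro mult_right_mono) auto
    finally have "measure M (ball z R - K) \<le> \<delta> * m" .
    moreover have "K \<in> sets borel"
      unfolding K_def using open_open_nbhd by (intro borel_comp borel_open)
    ultimately have "ennreal (R powr (- \<alpha>) / \<epsilon>)
        \<le> (\<integral>\<^sup>+ y\<in>ball z R. (indicator K y / ennreal (infdist y E powr \<alpha>)) \<partial>M) / ennreal m"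
      using \<delta>[of z R K] \<open>z \<in> E\<close> R by (simp add: m_def emeasure_ball_eq)
    also have "\<dots> \<le> (\<integral>\<^sup>+ y. (\<Sum>j<N. ennreal ((2 ^ Suc j / R) powr \<alpha>) * indicator (?F j) y) \<partial>M)
        / ennreal m"
    proof (intro divide_right_mono_ennreal nn_integral_mono)
      fix y
      show "indicator K y / ennreal (infdist y E powr \<alpha>) * indicator (ball z R) y
          \<le> (\<Sum>j<N. ennreal ((2 ^ Suc j / R) powr \<alpha>) * indicator (?F j) y)"
      proof (cases "y \<in> K \<inter> ball z R")
        case True
        have "R / 2 ^ N > 0"
          using R by simp
        moreover have far: "R / 2 ^ N \<le> infdist y E"
          using True by (auto simp: K_def open_nbhd_def)
        moreover have "infdist y E < R"
          using True ball_subset_open_nbhd[OF \<open>z \<in> E\<close>, of R] by (auto simp: open_nbhd_def)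
        ultimately obtain j where j: "j < N" "infdist y E < R / 2 ^ j"
            "1 / infdist y E powr \<alpha> \<le> (2 ^ Suc j / R) powr \<alpha>"
          using dyadic_layer_bound[of R "infdist y E" N \<alpha>] assms R by metis
        have "indicator K y / ennreal (infdist y E powr \<alpha>) * indicator (ball z R) y
            = ennreal (1 / infdist y E powr \<alpha>)"
          using True far \<open>R / 2 ^ N > 0\<close> upper_Aikawa_integrand(2)[of y K E \<alpha>] by auto
        also have "\<dots> \<le> ennreal ((2 ^ Suc j / R) powr \<alpha>) * indicator (?F j) y"
          using j True by (auto simp: open_nbhd_def intro: ennreal_leI)
        also have "\<dots> \<le> (\<Sum>j<N. ennreal ((2 ^ Suc j / R) powr \<alpha>) * indicator (?F j) y)"
          using j by (intro member_le_sum) auto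
        finally show ?thesis .
      qed (auto simp: indicator_def)
    qed
    also have "(\<integral>\<^sup>+ y. (\<Sum>j<N. ennreal ((2 ^ Suc j / R) powr \<alpha>) * indicator (?F j) y) \<partial>M)
        = (\<Sum>j<N. ennreal ((2 ^ Suc j / R) powr \<alpha>) * emeasure M (?F j))"
      by (subst nn_integral_sum) (simp_all add: nn_integral_cmult_indicator)
    also have "\<dots> = ennreal (\<Sum>j<N. (2 ^ Suc j / R) powr \<alpha> * measure M (?F j))"
      by (simp add: emeasure_Int_ball_eq open_in_sets open_open_nbhd flip: sum_ennreal ennreal_mult)
    also have "\<dots> / ennreal m \<le> ennreal (D * R powr (- \<alpha>) * m) / ennreal m"
    proof (intro divide_right_mono_ennreal ennreal_leI)
      have "(\<Sum>j<N. (2 ^ Suc j / R) powr \<alpha> * measure M (?F j))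
          \<le> (\<Sum>j<N. (2 ^ Suc j / R) powr \<alpha> * (C * (1 / 2 ^ j) powr Q * m))"
        by (intro sum_mono mult_left_mono small) auto
      also have "\<dots> = (\<Sum>j<N. 2 powr \<alpha> * C * R powr (- \<alpha>) * m * q ^ j)"
      proof (rule sum.cong[OF refl])
        fix j
        have "(2 ^ Suc j / R) powr \<alpha> = 2 powr \<alpha> * (2 powr \<alpha>) ^ j * R powr (- \<alpha>)"
          using R by (simp add: powr_divide powr_mult pow_powr powr_minus_divide)
        moreover have "(2 powr \<alpha>) ^ j * (2 powr (-Q)) ^ j = q ^ j"
          by (simp add: q_def flip: power_mult_distrib powr_add)
        ultimately show "(2 ^ Suc j / R) powr \<alpha> * (C * (1 / 2 ^ j) powr Q * m)
            = 2 powr \<alpha> * C * R powr (- \<alpha>) * m * q ^ j"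
          by (simp add: powr_half mult_ac)
      qed
      also have "\<dots> = 2 powr \<alpha> * C * R powr (- \<alpha>) * m * (\<Sum>j<N. q ^ j)"
        by (simp add: sum_distrib_left)
      also have "\<dots> \<le> 2 powr \<alpha> * C * R powr (- \<alpha>) * m * (1 / (1 - q))"
      proof (intro mult_left_mono)
        have "(\<Sum>j<N. q ^ j) \<le> (\<Sum>j. q ^ j)"
          using q by (intro sum_le_suminf summable_geometric) auto
        then show "(\<Sum>j<N. q ^ j) \<le> 1 / (1 - q)"
          using q by (simp add: suminf_geometric)
      qed (use assms m in auto)
      finally show "(\<Sum>j<N. (2 ^ Suc j / R) powr \<alpha> * measure M (?F j)) \<le> D * R powr (- \<alpha>) * m"
        by (simp add: D_def mult_ac)
    qed
    also have "\<dots> = ennreal (D * R powr (- \<alpha>))"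
      using m D by (subst divide_ennreal) auto
    finally have "R powr (- \<alpha>) / \<epsilon> \<le> D * R powr (- \<alpha>)"
      using D by (simp add: ennreal_le_iff)
    then have "2 * D * R powr (- \<alpha>) \<le> D * R powr (- \<alpha>)"
      by (simp add: \<epsilon>_def mult_ac)
    moreover have "D * R powr (- \<alpha>) > 0"
      using D R by simp
    ultimately show False
      by simp
  qed
qed

text \<open>The good-scale estimate is iterated from \<open>R\<close> down to \<open>r\<close>. The
  enlarged ball \<open>ball z (3 * R)\<close> leaves room for the balls of radius
  \<open>3 * s\<close> about centres in \<open>ball z (R + s)\<close>: as
  \<open>s \<le> R / 2\<close>, \<open>R + s + 3 * s \<le> 3 * R\<close>.\<close>

lemma upper_Aikawa_imp_thick_neighbourhood:
  assumes Aikawa: "upper_Aikawa M E \<alpha>" and "0 < \<alpha>" "\<alpha> < Q"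
  obtains b where "b > 0"
    "\<And>z r R. z \<in> E \<Longrightarrow> 0 < r \<Longrightarrow> r < 3 * R \<Longrightarrow> ennreal R < radius_bound E \<Longrightarrow>
      b * (r / R) powr Q * measure M (ball z R) \<le> measure M (open_nbhd E r \<inter> ball z (3 * R))"
proof -
  \<comment> \<open>The gain \<open>c ^ 3\<close> pays for the three doublings from balls of radius
    \<open>s\<close> to the covering balls of radius \<open>2 ^ 3 * s\<close>.\<close>
  have "1 \<le> c ^ 3"
    using c_gt_1 by simp
  with upper_Aikawa_good_scale[OF assms] obtain N where
    N: "\<And>z R. z \<in> E \<Longrightarrow> 0 < R \<Longrightarrow> ennreal R < radius_bound E \<Longrightarrow>
      \<exists>j\<in>{1..N}. c ^ 3 * (1 / 2 ^ j) powr Q * measure M (ball z R)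
        \<le> measure M (open_nbhd E (R / 2 ^ j) \<inter> ball z R)"
    by blast
  \<comment> \<open>Dictated by the range \<open>R \<le> 2 ^ N * r\<close>: \<open>c ^ N\<close> is
    the cost of shrinking \<open>R\<close> to \<open>R / 2 ^ N\<close>, and \<open>3 powr Q\<close>
    bounds \<open>(r / R) powr Q\<close>.\<close>
  define b where "b = 1 / (c ^ N * 3 powr Q)"
  have "b > 0"
    using c_gt_1 by (simp add: b_def)
  have base: "b * (r / R) powr Q * measure M (ball z R)
        \<le> measure M (open_nbhd E r \<inter> ball z (3 * R))"
    if "z \<in> E" "0 < r" "r < 3 * R" "R \<le> 2 ^ N * r" for z r R
  proof -
    have R: "R > 0"
      using that by linarith
    have "(r / R) powr Q \<le> 3 powr Q"
      using that assms R by (intro powr_mono2) (auto simp: field_simps)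
    then have "b * (r / R) powr Q \<le> b * 3 powr Q"
      using \<open>b > 0\<close> by simp
    also have "\<dots> = 1 / c ^ N"
      by (simp add: b_def)
    finally have "b * (r / R) powr Q * measure M (ball z R)
        \<le> 1 / c ^ N * measure M (ball z R)"
      by (rule mult_right_mono) simp
    also have "\<dots> = 1 / c ^ N * measure M (ball z (2 ^ N * (R / 2 ^ N)))"
      by simp
    also have "\<dots> \<le> 1 / c ^ N * (c ^ N * measure M (ball z (R / 2 ^ N)))"
      using R c_gt_1 by (intro mult_left_mono measure_ball_power) auto
    also have "\<dots> = measure M (ball z (R / 2 ^ N))"
      using c_gt_1 by simp
    also have "\<dots> \<le> measure M (open_nbhd E r \<inter> ball z (3 * R))"
    proof (rule measure_mono_fmeasurable)
      have "R / 2 ^ N \<le> r"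
        using that by (simp add: field_simps)
      moreover have "R / 2 ^ N \<le> 3 * R"
        using R one_le_power[of "2 :: real" N] frac_le[of R R 1 "2 ^ N"] by simp
      ultimately show "ball z (R / 2 ^ N) \<subseteq> open_nbhd E r \<inter> ball z (3 * R)"
        using ball_subset_open_nbhd[OF \<open>z \<in> E\<close>, of r]
        by (meson Int_greatest order_trans subset_ball)
    qed (auto intro!: Int_ball_fmeasurable)
    finally show ?thesis .
  qed
  \<comment> \<open>Induction on the number of halvings that take \<open>R\<close> to at most
    \<open>r\<close>, with the same \<open>b\<close> throughout. Since \<open>j \<ge> 1\<close>,
    passing from \<open>R\<close> to \<open>s\<close> uses up at least one halving.\<close>
  have thick: "b * (r / R) powr Q * measure M (ball z R)
        \<le> measure M (open_nbhd E r \<inter> ball z (3 * R))"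
    if "z \<in> E" "0 < r" "r < 3 * R" "ennreal R < radius_bound E" "R \<le> 2 ^ n * r" for n z r R
    using that
  proof (induction n arbitrary: z R)
    case 0
    then have "R \<le> 1 * r"
      by simp
    also have "\<dots> \<le> 2 ^ N * r"
      using 0 by (intro mult_right_mono) auto
    finally show ?case
      using 0 by (intro base)
  next
    case (Suc n)
    show ?case
    proof (cases "R \<le> 2 ^ N * r")
      case True
      then show ?thesis
        using Suc.prems by (intro base) auto
    next
      case False
      have R: "R > 0"
        using Suc.prems by linarith
      with N[of z R] Suc.prems obtain j where j: "j \<in> {1..N}" and
        Fj: "c ^ 3 * (1 / 2 ^ j) powr Q * measure M (ball z R)
          \<le> measure M (open_nbhd E (R / 2 ^ j) \<inter> ball z R)"
        by blast
      define s where "s = R / 2 ^ j"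
      have s: "s > 0"
        using R by (simp add: s_def)
      have "(2::real) ^ j \<le> 2 ^ N"
        using j by (intro power_increasing) auto
      then have "R / 2 ^ N \<le> s"
        using R by (simp add: s_def frac_le)
      moreover have "r < R / 2 ^ N"
        using False by (simp add: field_simps)
      ultimately have "r < s"
        by simp
      have "(2::real) ^ 1 \<le> 2 ^ j"
        using j by (intro power_increasing) auto
      then have s_half: "s \<le> R / 2"
        unfolding s_def using R by (intro divide_left_mono) auto
      \<comment> \<open>Separation \<open>6 * s\<close> makes the balls of radius
        \<open>3 * s\<close> disjoint. Centres range up to distance \<open>R + s\<close> because a
        point of \<open>ball z R\<close> may have its nearby points of \<open>E\<close> outside that
        ball; the net distance \<open>6 * s\<close> plus \<open>s\<close> stays below
        \<open>2 ^ 3 * s\<close>.\<close>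
      obtain W where W: "finite W" "W \<subseteq> E \<inter> ball z (R + s)"
          "pairwise (\<lambda>v w. 2 * (3 * s) \<le> dist v w) W"
        and cover: "\<And>a. a \<in> E \<inter> ball z (R + s) \<Longrightarrow> \<exists>w\<in>W. dist w a < 2 * (3 * s)"
        using exists_maximal_separated[of "2 * (3 * s)" "E \<inter> ball z (R + s)" z "R + s"] s
        by auto
      have F_cover: "open_nbhd E s \<inter> ball z R \<subseteq> (\<Union>w\<in>W. ball w (2 ^ 3 * s))"
      proof
        fix y assume y: "y \<in> open_nbhd E s \<inter> ball z R"
        then have "infdist y E < s" "E \<noteq> {}"
          using \<open>z \<in> E\<close> by (auto simp: open_nbhd_def)
        then obtain a where a: "a \<in> E" "dist y a < s"
          by (auto simp: infdist_def cINF_less_iff)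
        have "dist z a < R + s"
          using y a dist_triangle[of z a y] by simp
        then obtain w where w: "w \<in> W" "dist w a < 2 * (3 * s)"
          using cover a by auto
        then have "dist w y < 2 ^ 3 * s"
          using a dist_triangle2[of w y a] s by simp
        then show "y \<in> (\<Union>w\<in>W. ball w (2 ^ 3 * s))"
          using w by auto
      qed
      have split: "(r / R) powr Q = (r / s) powr Q * (1 / 2 ^ j) powr Q"
        using R s \<open>0 < r\<close> by (simp add: s_def flip: powr_mult)
      have "b * (r / R) powr Q * measure M (ball z R)
          = b * (r / s) powr Q * ((1 / 2 ^ j) powr Q * measure M (ball z R))"
        by (simp add: split mult_ac)
      also have "\<dots> \<le> b * (r / s) powr Q * (1 / c ^ 3 * measure M (open_nbhd E s \<inter> ball z R))"
        using Fj \<open>b > 0\<close> c_gt_1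
        by (intro mult_left_mono) (auto simp: s_def field_simps)
      also have "\<dots> \<le> b * (r / s) powr Q * (1 / c ^ 3 * (\<Sum>w\<in>W. measure M (ball w (2 ^ 3 * s))))"
      proof (intro mult_left_mono)
        have "measure M (open_nbhd E s \<inter> ball z R) \<le> measure M (\<Union>w\<in>W. ball w (2 ^ 3 * s))"
          using F_cover W(1) by (intro measure_mono_fmeasurable fmeasurable.finite_UN) auto
        also have "\<dots> \<le> (\<Sum>w\<in>W. measure M (ball w (2 ^ 3 * s)))"
          using W(1) by (intro measure_UNION_le) auto
        finally show "measure M (open_nbhd E s \<inter> ball z R)
            \<le> (\<Sum>w\<in>W. measure M (ball w (2 ^ 3 * s)))" .
      qed (use \<open>b > 0\<close> c_gt_1 in auto)
      also have "\<dots> \<le> b * (r / s) powr Q * (1 / c ^ 3 * (\<Sum>w\<in>W. c ^ 3 * measure M (ball w s)))"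
        using \<open>b > 0\<close> c_gt_1 s by (intro mult_left_mono sum_mono measure_ball_power) auto
      also have "\<dots> = (\<Sum>w\<in>W. b * (r / s) powr Q * measure M (ball w s))"
        using c_gt_1 by (simp add: sum_distrib_left)
      also have "\<dots> \<le> (\<Sum>w\<in>W. measure M (open_nbhd E r \<inter> ball w (3 * s)))"
      proof (intro sum_mono Suc.IH)
        have "s \<le> R"
          using s_half R by simp
        then show "ennreal s < radius_bound E"
          using Suc.prems(4) by (meson ennreal_leI le_less_trans)
      qed (use W Suc.prems \<open>r < s\<close> s_half in auto)
      also have "\<dots> \<le> measure M (open_nbhd E r \<inter> ball z (3 * R))"
      proof (rule sum_measure_balls_le)
        fix w assume "w \<in> W"
        then have "dist w z + 3 * s \<le> 3 * R"
          using W(2) s_half by (auto simp: dist_commute)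
        then show "ball w (3 * s) \<subseteq> ball z (3 * R)"
          by (rule ball_subset_ballI)
      qed (use W in auto)
      finally show ?thesis .
    qed
  qed
  show ?thesis
  proof (rule that[OF \<open>b > 0\<close>])
    fix z r R assume *: "z \<in> E" "0 < r" "r < 3 * R" "ennreal R < radius_bound E"
    obtain n where "R / r < 2 ^ n"
      using real_arch_pow[of 2 "R / r"] by auto
    then have "R \<le> 2 ^ n * r"
      using * by (simp add: field_simps)
    with * show "b * (r / R) powr Q * measure M (ball z R)
        \<le> measure M (open_nbhd E r \<inter> ball z (3 * R))"
      by (intro thick)
  qed
qed

text \<open>The thick neighbourhood estimate is applied with \<open>R / 3\<close>, whose enlarged
  ball is \<open>ball z R\<close>. As \<open>3 \<le> 2 ^ 2\<close>, the change of normalisation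
  costs two doublings, that is, \<open>c ^ 2\<close>.\<close>

lemma Assouad_if_upper_Aikawa:
  assumes "upper_Aikawa M E \<alpha>" "0 < \<alpha>" "\<alpha> < Q"
  shows "\<exists>b>0. \<forall>z\<in>E. \<forall>r R. 0 < r \<and> r < R \<and> ennreal R < radius_bound E \<longrightarrow>
          measure M (open_nbhd E r \<inter> ball z R) / measure M (ball z R) \<ge> b * (r / R) powr Q"
proof -
  from upper_Aikawa_imp_thick_neighbourhood[OF assms] obtain b where "b > 0" and
    b: "\<And>z r R. z \<in> E \<Longrightarrow> 0 < r \<Longrightarrow> r < 3 * R \<Longrightarrow> ennreal R < radius_bound E \<Longrightarrow>
      b * (r / R) powr Q * measure M (ball z R) \<le> measure M (open_nbhd E r \<inter> ball z (3 * R))"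
    by blast
  show ?thesis
  proof (intro exI[of _ "b / c ^ 2"] conjI ballI allI impI; (elim conjE)?)
    show "b / c ^ 2 > 0"
      using \<open>b > 0\<close> c_gt_1 by simp
    fix z r R assume *: "z \<in> E" "0 < r" "r < R" "ennreal R < radius_bound E"
    have "ennreal (R / 3) < radius_bound E"
      using * by (intro le_less_trans[OF _ *(4)] ennreal_leI) auto
    then have "b * (r / (R / 3)) powr Q * measure M (ball z (R / 3))
        \<le> measure M (open_nbhd E r \<inter> ball z R)"
      using b[of z r "R / 3"] * by simp
    moreover have "measure M (ball z R) / c ^ 2 \<le> measure M (ball z (R / 3))"
    proof -
      have "measure M (ball z R) \<le> measure M (ball z (2 ^ 2 * (R / 3)))"
        using * by (intro measure_mono_ball subset_ball) auto
      also have "\<dots> \<le> c ^ 2 * measure M (ball z (R / 3))"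
        using * by (intro measure_ball_power) auto
      finally show ?thesis
        using c_gt_1 by (simp add: field_simps)
    qed
    moreover have "b * (r / R) powr Q \<le> b * (r / (R / 3)) powr Q"
      using * \<open>b > 0\<close> assms by (intro mult_left_mono powr_mono2) (auto simp: field_simps)
    ultimately have "b * (r / R) powr Q * (measure M (ball z R) / c ^ 2)
        \<le> measure M (open_nbhd E r \<inter> ball z R)"
      using \<open>b > 0\<close> by (smt (verit, best) mult_mono measure_nonneg mult_nonneg_nonneg powr_ge_zero divide_nonneg_nonneg zero_le_power2)
    moreover have "measure M (ball z R) > 0"
      using * by (intro measure_ball_pos) auto
    ultimately show "b / c ^ 2 * (r / R) powr Q
        \<le> measure M (open_nbhd E r \<inter> ball z R) / measure M (ball z R)"
      by (simp add: field_simps)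
  qed
qed

end

section \<open>Comparison of the two infima\<close>

text \<open>Each implication between the two conditions needs a strictly larger exponent; an
  arbitrarily small increase is invisible to the infimum. If \<open>B\<close> is empty, the
  right-hand side is \<open>\<infinity>\<close>.\<close>

lemma ereal_Inf_le_if_dense:
  fixes A B :: "real set"
  assumes "\<And>x y. x \<in> B \<Longrightarrow> x < y \<Longrightarrow> y \<in> A"
  shows "Inf (ereal ` A) \<le> Inf (ereal ` B)"
proof (rule Inf_greatest)
  fix u assume "u \<in> ereal ` B"
  then obtain x where x: "x \<in> B" "u = ereal x"
    by auto
  show "Inf (ereal ` A) \<le> u"
  proof (rule ereal_le_epsilon2)
    fix e :: real assume "0 < e"
    then have "x + e \<in> A"
      using assms[of x "x + e"] x by simp
    then show "Inf (ereal ` A) \<le> u + ereal e"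
      using x by (auto intro: Inf_lower)
  qed
qed

theorem theorem5p3:
  fixes M :: "'a::metric_space measure" and E :: "'a set"
  assumes "doubling_metric_measure M"
    and "E \<noteq> {}"
  shows "upper_Assouad_codim M E = Inf (ereal ` {\<alpha>. \<alpha> > 0 \<and> upper_Aikawa M E \<alpha>})"
proof -
  from assms(1) obtain c where "doubling_measure M c"
    unfolding doubling_metric_measure_def doubling_measure_def by blast
  then interpret doubling_measure M c .
  show ?thesis
    unfolding upper_Assouad_codim_def
  proof (rule antisym; rule ereal_Inf_le_if_dense)
    fix x y assume "x \<in> {\<alpha>. \<alpha> > 0 \<and> upper_Aikawa M E \<alpha>}" "x < y"
    then show "y \<in> {Q. Q \<ge> 0 \<and>
       (\<exists>c>0. \<forall>z\<in>E. \<forall>r R. 0 < r \<and> r < R \<and> ennreal R < radius_bound E \<longrightarrow>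
          measure M (open_nbhd E r \<inter> ball z R) / measure M (ball z R) \<ge> c * (r / R) powr Q)}"
      using Assouad_if_upper_Aikawa[of E x y] by auto
  next
    fix x y assume *: "x \<in> {Q. Q \<ge> 0 \<and>
       (\<exists>c>0. \<forall>z\<in>E. \<forall>r R. 0 < r \<and> r < R \<and> ennreal R < radius_bound E \<longrightarrow>
          measure M (open_nbhd E r \<inter> ball z R) / measure M (ball z R) \<ge> c * (r / R) powr Q)}"
      "x < y"
    then obtain b where "b > 0" "\<And>z r R. z \<in> E \<Longrightarrow> 0 < r \<Longrightarrow> r < R \<Longrightarrow>
        ennreal R < radius_bound E \<Longrightarrow>
        measure M (open_nbhd E r \<inter> ball z R) / measure M (ball z R) \<ge> b * (r / R) powr x"
      by blast
    with * show "y \<in> {\<alpha>. \<alpha> > 0 \<and> upper_Aikawa M E \<alpha>}"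
      using upper_Aikawa_if_Assouad[of x y b E] by auto
  qed
qed

end
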